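(* Let $k\ge g\ge 2$ be integers. For $j\in\{1,\dots,g\}$, let $\beta,\alpha_1,\alpha_2\in\mathbb{C}^*$ with $\alpha_1\neq\alpha_2$ be such that the polynomial $\beta x^{2j-1}(x-\alpha_1)(x-\alpha_2)$ is real. Let $C_j$ be the normalization of the compactification in $\mathbb{P}^1\times\mathbb{P}^1$ of the curve $y^2=\beta x^{2j-1}(x-\alpha_1)(x-\alpha_2)$, and let $H_j\subset H^0(C_j,\mathcal{L}_{\mathbb{R}}(2k\cdot\infty))$ be the real vector space spanned by $$1,x,\dots,x^k;\quad y,xy,\dots,x^{k-g-1}y.$$ Then the inflectionary weights of $H_j$ in the marked points $0$, $\infty$, $(\alpha_1,0)$ and $(\alpha_2,0)$ of $C_j$ are given by $$|0|=\binom{g+1}{2}+2(k-g)(j-1),$$ $$|\infty|=\binom{g+1}{2}+2(k-g)(g-j),$$ $$|(\alpha_1,0)|=|(\alpha_2,0)|=\binom{g+1}{2}.$$ In particular, $|0|+|\infty|=2\binom{g+1}{2}+2(k-g)(g-1)$, irrespective of $j$.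
   Context: $C_j$ is a real curve of genus $1$, with real structure induced by $(x,y)\mapsto(\overline{x},\overline{y})$. The points $0$ and $\infty$ of $C_j$ are the unique points lying over $x=0$ and $x=\infty$ under the degree-two map $(x,y)\mapsto x$. $\mathcal{L}_{\mathbb{R}}(2k\cdot\infty)$ is the real line bundle defined by the divisor $2k\cdot\infty$, whose real sections are identified with the real rational functions with poles at most of order $2k$ at $\infty$ and no other poles. Vanishing orders are taken as sections of this line bundle: a function $h$ vanishes at $p\ne\infty$ to order $\mathrm{ord}_p(h)$ and at $\infty$ to order $\mathrm{ord}_\infty(h)+2k$. When $k=g$ the list $y,xy,\dots,x^{k-g-1}y$ is empty. The inflectionary weight $|P|$ of a linear series of rank $r$ in a point $P$ is $\sum_{i=0}^r(o_i-i)$, where $o_0<\dots<o_r$ are the vanishing orders at $P$ of its nonzero (complexified) sections. *)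

theory Defs
  imports
    "HOL-Analysis.Analysis"
    "HOL-Library.Product_Plus"
    "HOL-Computational_Algebra.Polynomial_Factorial"
begin

text \<open>
  Throughout, \<open>f\<close> is a complex polynomial that is not a square, describing the
  affine curve \<open>y\<^sup>2 = f(x)\<close>.  Its function field is the quadratic extension
  \<open>\<complex>(x)[y]/(y\<^sup>2 - f(x))\<close>; the pair \<open>(a, b)\<close> stands for \<open>a + b y\<close> with
  \<open>a, b\<close> in \<open>\<complex>(x)\<close>.  Addition and zero are the componentwise ones, and only the
  multiplication depends on \<open>f\<close>.
\<close>

type_synonym ratfun = "complex poly fract"
type_synonym curvefun = "ratfun \<times> ratfun"

definition cmult :: "complex poly \<Rightarrow> curvefun \<Rightarrow> curvefun \<Rightarrow> curvefun" where
  "cmult f g h =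
     (fst g * fst h + snd g * snd h * to_fract f, fst g * snd h + snd g * fst h)"

definition cconst :: "complex \<Rightarrow> curvefun" where
  "cconst c = (to_fract [:c:], 0)"

definition ratX :: ratfun where
  "ratX = to_fract [:0, 1:]"

definition funX :: curvefun where
  "funX = (ratX, 0)"

definition funY :: curvefun where
  "funY = (0, 1)"

definition cscale :: "complex \<Rightarrow> curvefun \<Rightarrow> curvefun" where
  "cscale c g = (to_fract [:c:] * fst g, to_fract [:c:] * snd g)"

definition rscale :: "real \<Rightarrow> curvefun \<Rightarrow> curvefun" where
  "rscale r = cscale (of_real r)"

lemma to_fract_const_add: "to_fract [:a + b:] = to_fract [:a:] + to_fract [:b::complex:]"
proof -
  have "[:a + b:] = [:a:] + [:b:]" by simp
  then show ?thesis by (simp only: to_fract_add)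
qed

lemma to_fract_const_mult: "to_fract [:a * b:] = to_fract [:a:] * to_fract [:b::complex:]"
proof -
  have "[:a * b:] = [:a:] * [:b:]" by simp
  then show ?thesis by (simp only: to_fract_mult)
qed

lemma to_fract_const_one: "to_fract [:1::complex:] = 1"
  by (metis one_pCons to_fract_1)

interpretation CF: vector_space cscale
  by unfold_locales
    (auto simp: cscale_def to_fract_const_add to_fract_const_mult to_fract_const_one
      algebra_simps prod_eq_iff)

interpretation RF: vector_space rscale
  by unfold_locales
    (auto simp: rscale_def cscale_def to_fract_const_add to_fract_const_mult
      to_fract_const_one algebra_simps prod_eq_iff)


section \<open>The compactification and its normalization\<close>

text \<open>The projective line is \<open>complex option\<close>, with \<open>None\<close> the point at infinity.\<close>

definition tendsto_P1 :: "(nat \<Rightarrow> complex) \<Rightarrow> complex option \<Rightarrow> bool" where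
  "tendsto_P1 s p =
     (case p of Some a \<Rightarrow> s \<longlonglongrightarrow> a | None \<Rightarrow> filterlim s at_infinity sequentially)"

text \<open>
  The closure in \<open>P\<^sup>1 \<times> P\<^sup>1\<close> of the affine curve \<open>y\<^sup>2 = f(x)\<close>.  The closure of a
  constructible set is the same in the Zariski and in the classical topology, and since
  \<open>P\<^sup>1 \<times> P\<^sup>1\<close> is metrizable the latter is the set of limits of sequences.
\<close>

definition compactification :: "complex poly \<Rightarrow> (complex option \<times> complex option) set" where
  "compactification f =
     {(p, q). \<exists>s t. (\<forall>n. (t n)\<^sup>2 = poly f (s n)) \<and> tendsto_P1 s p \<and> tendsto_P1 t q}"

text \<open>
  Normalized discrete valuations of the function field over \<open>\<complex>\<close>.  The value at \<open>0\<close>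
  (usually infinity) is set to \<open>0\<close>, so that each valuation is one function; it carries
  no meaning.
\<close>

definition discrete_valuation :: "complex poly \<Rightarrow> (curvefun \<Rightarrow> int) \<Rightarrow> bool" where
  "discrete_valuation f v \<longleftrightarrow>
     (\<forall>g h. g \<noteq> 0 \<longrightarrow> h \<noteq> 0 \<longrightarrow> v (cmult f g h) = v g + v h) \<and>
     (\<forall>g h. g \<noteq> 0 \<longrightarrow> h \<noteq> 0 \<longrightarrow> g + h \<noteq> 0 \<longrightarrow> min (v g) (v h) \<le> v (g + h)) \<and>
     (\<forall>c. c \<noteq> 0 \<longrightarrow> v (cconst c) = 0) \<and>
     (\<exists>g. g \<noteq> 0 \<and> v g = 1) \<and>
     v 0 = 0"

text \<open>The function \<open>h\<close> takes the value \<open>p\<close>, possibly infinite, at the point \<open>v\<close>.\<close>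

definition has_value :: "(curvefun \<Rightarrow> int) \<Rightarrow> curvefun \<Rightarrow> complex option \<Rightarrow> bool" where
  "has_value v h p =
     (case p of
        Some c \<Rightarrow> h = cconst c \<or> v (h - cconst c) > 0
      | None \<Rightarrow> h \<noteq> 0 \<and> v h < 0)"

text \<open>The point \<open>v\<close> lies over the point \<open>p\<close> of \<open>P\<^sup>1 \<times> P\<^sup>1\<close>.\<close>

definition lies_over :: "(curvefun \<Rightarrow> int) \<Rightarrow> complex option \<times> complex option \<Rightarrow> bool" where
  "lies_over v p \<longleftrightarrow> has_value v funX (fst p) \<and> has_value v funY (snd p)"

text \<open>
  The local rings at the points of the normalization over a point \<open>p\<close> are exactly the
  discrete valuation rings of the function field that dominate the local ring at \<open>p\<close>.
  Hence the points over \<open>p\<close> are the discrete valuations lying over \<open>p\<close>, and the order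
  of vanishing of \<open>h\<close> at the point \<open>v\<close> is \<open>v h\<close>.
\<close>

type_synonym point = "curvefun \<Rightarrow> int"

definition normalization :: "complex poly \<Rightarrow> point set" where
  "normalization f =
     {v. discrete_valuation f v \<and> (\<exists>p \<in> compactification f. lies_over v p)}"

definition point_over_x :: "complex poly \<Rightarrow> complex option \<Rightarrow> point" where
  "point_over_x f p = (THE v. v \<in> normalization f \<and> has_value v funX p)"

definition point_over :: "complex poly \<Rightarrow> complex option \<times> complex option \<Rightarrow> point" where
  "point_over f p = (THE v. v \<in> normalization f \<and> lies_over v p)"


section \<open>Real structure\<close>

lemma map_poly_cnj_mult: "map_poly cnj (p * q) = map_poly cnj p * map_poly cnj q"
  by (rule poly_eqI) (simp add: coeff_map_poly coeff_mult)

lemma map_poly_cnj_eq_0: "map_poly cnj p = 0 \<longleftrightarrow> p = 0"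
  by (simp add: poly_eq_iff coeff_map_poly)

definition cnj_ratfun :: "ratfun \<Rightarrow> ratfun" where
  "cnj_ratfun a =
     (THE b. \<exists>p q. q \<noteq> 0 \<and> a = Fract p q \<and> b = Fract (map_poly cnj p) (map_poly cnj q))"

lemma cnj_ratfun_Fract:
  assumes "q \<noteq> 0"
  shows "cnj_ratfun (Fract p q) = Fract (map_poly cnj p) (map_poly cnj q)"
  unfolding cnj_ratfun_def
proof (rule the_equality)
  fix b
  assume "\<exists>p' q'. q' \<noteq> 0 \<and> Fract p q = Fract p' q' \<and> b = Fract (map_poly cnj p') (map_poly cnj q')"
  then obtain p' q' where *: "q' \<noteq> 0" "Fract p q = Fract p' q'"
    "b = Fract (map_poly cnj p') (map_poly cnj q')"
    by blast
  then have "p * q' = p' * q"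
    using assms by (simp add: eq_fract)
  then have "map_poly cnj p * map_poly cnj q' = map_poly cnj p' * map_poly cnj q"
    by (metis map_poly_cnj_mult)
  then show "b = Fract (map_poly cnj p) (map_poly cnj q)"
    using * assms by (simp add: eq_fract map_poly_cnj_eq_0)
qed (use assms in blast)

text \<open>
  For real \<open>f\<close>, the involution \<open>h \<mapsto> cnj \<circ> h \<circ> \<tau>\<close> of the function field, where
  \<open>\<tau> (x, y) = (cnj x, cnj y)\<close>.
\<close>

definition cnj_curvefun :: "curvefun \<Rightarrow> curvefun" where
  "cnj_curvefun h = (cnj_ratfun (fst h), cnj_ratfun (snd h))"

definition real_curvefun :: "curvefun \<Rightarrow> bool" where
  "real_curvefun h \<longleftrightarrow> cnj_curvefun h = h"


section \<open>Linear series and inflectionary weights\<close>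

type_synonym divisor = "point \<Rightarrow> int"

definition point_divisor :: "int \<Rightarrow> point \<Rightarrow> divisor" where
  "point_divisor n P = (\<lambda>Q. if Q = P then n else 0)"

definition real_sections :: "complex poly \<Rightarrow> divisor \<Rightarrow> curvefun set" where
  "real_sections f D =
     {h. real_curvefun h \<and> (h = 0 \<or> (\<forall>P \<in> normalization f. P h + D P \<ge> 0))}"

text \<open>
  A linear series is given by a real subspace \<open>V\<close> of the real sections.  Real functions
  that are linearly independent over the reals are so over the complex numbers, hence the
  complexification of \<open>V\<close> is its complex span.  A function \<open>h\<close> vanishes at \<open>P\<close>, as a
  section of the line bundle of \<open>D\<close>, to order \<open>P h + D P\<close>.
\<close>

definition vanishing_orders :: "divisor \<Rightarrow> curvefun set \<Rightarrow> point \<Rightarrow> int set" where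
  "vanishing_orders D V P = {P h + D P | h. h \<in> CF.span V \<and> h \<noteq> 0}"

definition series_rank :: "curvefun set \<Rightarrow> nat" where
  "series_rank V = RF.dim V - 1"

definition inflection_weight :: "divisor \<Rightarrow> curvefun set \<Rightarrow> point \<Rightarrow> int" where
  "inflection_weight D V P =
     (\<Sum>i = 0..series_rank V. sorted_list_of_set (vanishing_orders D V P) ! i - int i)"


section \<open>The curves and the linear series of interest\<close>

definition curve_poly :: "nat \<Rightarrow> complex \<Rightarrow> complex \<Rightarrow> complex \<Rightarrow> complex poly" where
  "curve_poly j \<beta> \<alpha>1 \<alpha>2 = smult \<beta> ([:0, 1:] ^ (2 * j - 1) * [:-\<alpha>1, 1:] * [:-\<alpha>2, 1:])"

text \<open>The divisor \<open>2k \<cdot> \<infinity>\<close>.\<close>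

definition div_infinity :: "nat \<Rightarrow> complex poly \<Rightarrow> divisor" where
  "div_infinity k f = point_divisor (2 * int k) (point_over_x f None)"

text \<open>The pairs below are \<open>x\<^sup>i\<close> for \<open>i \<le> k\<close> and \<open>x\<^sup>i y\<close> for \<open>0 \<le> i \<le> k - g - 1\<close>,
  the latter family being empty for \<open>k = g\<close>.\<close>

definition series_H :: "nat \<Rightarrow> nat \<Rightarrow> curvefun set" where
  "series_H k g = RF.span ({(ratX ^ i, 0) | i. i \<le> k} \<union> {(0, ratX ^ i) | i. i < k - g})"

end

theory Submission
  imports Defs "HOL-Computational_Algebra.Fundamental_Theorem_Algebra"
begin

text \<open>
  The double cover \<open>x\<close> is branched over \<open>0\<close>, \<open>\<infinity>\<close>, \<open>\<alpha>1\<close> and \<open>\<alpha>2\<close>, because \<open>f\<close> has odd order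
  \<open>2j - 1\<close>, \<open>-(2j + 1)\<close>, \<open>1\<close> and \<open>1\<close> there.  Let \<open>d\<close> be the order of polynomials at such a branch
  point and \<open>w\<close> its extension to \<open>\<complex>(x)\<close>.  Any discrete valuation \<open>v\<close> of the function field over this
  point restricts to a positive multiple of \<open>w\<close>, and \<open>2 v(y) = v(f)\<close> with \<open>d(f)\<close> odd.  Hence the
  values of \<open>a(x)\<close> and \<open>b(x) y\<close> never coincide, and normalization leaves only

    \<open>v(a + b y) = min (2 w(a)) (2 w(b) + d(f))\<close>.

  Conversely this formula defines a valuation, which is easiest to see by writing it as
  \<open>w(a\<^sup>2 - b\<^sup>2 f)\<close>, the value of the norm of \<open>a + b y\<close>.  Existence is
  \<open>discrete_valuation_place\<close>, uniqueness is \<open>valuation_eq_place\<close>.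

  The complexified series consists of all \<open>p(x) + q(x) y\<close> with \<open>deg p \<le> k\<close> and \<open>deg q < k - g\<close>
  (\<open>CF_span_series_H\<close>).  By the formula its vanishing orders at a branch point are the even numbers
  \<open>0, 2, ..., 2k\<close> and \<open>k - g\<close> consecutive odd numbers starting with some \<open>c\<close>
  (\<open>vanishing_orders_series_H\<close>).  At a finite point \<open>c = d(f)\<close>.  At infinity, where orders are taken
  as sections of the line bundle of \<open>2k \<cdot> \<infinity>\<close>, the smallest odd order belongs to
  \<open>x ^ (k - g - 1) y\<close>, which gives \<open>c = 2 (g - j) + 1\<close>.  Summing both progressions yields the weight
  \<open>(g + 1 choose 2) + (k - g) (c - 1)\<close> (\<open>inflection_weight_even_odd\<close>) in all four cases.
\<close>

section \<open>Extending valuations from polynomials to rational functions\<close>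

definition rat_val :: "(complex poly \<Rightarrow> int) \<Rightarrow> ratfun \<Rightarrow> int" where
  "rat_val d r =
     (THE n. \<exists>p q. p \<noteq> 0 \<and> q \<noteq> 0 \<and> r = Fract p q \<and> n = d p - d q)"

lemma fract_cases:
  assumes "r \<noteq> (0 :: ratfun)"
  obtains p q where "r = Fract p q" "p \<noteq> 0" "q \<noteq> 0"
  by (metis assms Fract_cases_nonzero)

text \<open>
  The two instances that matter are the order at a point of \<open>\<complex>\<close> and minus the degree, the order
  at infinity.  The uniformizer may have value \<open>-1\<close>, because polynomials have poles at infinity
  but no zeros; its inverse is then a rational function of value \<open>1\<close>.
\<close>

locale poly_valuation =
  fixes d :: "complex poly \<Rightarrow> int"
  assumes mult: "p \<noteq> 0 \<Longrightarrow> q \<noteq> 0 \<Longrightarrow> d (p * q) = d p + d q"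
    and add: "p \<noteq> 0 \<Longrightarrow> q \<noteq> 0 \<Longrightarrow> p + q \<noteq> 0 \<Longrightarrow> min (d p) (d q) \<le> d (p + q)"
    and const: "c \<noteq> 0 \<Longrightarrow> d [:c:] = 0"
    and uniformizer: "\<exists>t. t \<noteq> 0 \<and> \<bar>d t\<bar> = 1"
begin

abbreviation w :: "ratfun \<Rightarrow> int" where "w \<equiv> rat_val d"

lemma one: "d 1 = 0"
  using const[of 1] by (simp add: one_pCons)

lemma rat_val_Fract:
  assumes "p \<noteq> 0" "q \<noteq> 0"
  shows "w (Fract p q) = d p - d q"
  unfolding rat_val_def
proof (rule the_equality)
  fix n
  assume "\<exists>p' q'. p' \<noteq> 0 \<and> q' \<noteq> 0 \<and> Fract p q = Fract p' q' \<and> n = d p' - d q'"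
  then obtain p' q' where *: "p' \<noteq> 0" "q' \<noteq> 0" "Fract p q = Fract p' q'" "n = d p' - d q'"
    by blast
  then have "p * q' = p' * q" using assms by (simp add: eq_fract)
  then have "d p + d q' = d p' + d q" using assms * mult by metis
  then show "n = d p - d q" using * by simp
qed (use assms in blast)

lemma rat_val_to_fract: "p \<noteq> 0 \<Longrightarrow> w (to_fract p) = d p"
  unfolding to_fract_def by (simp add: rat_val_Fract one)

lemma rat_val_mult:
  assumes "r \<noteq> 0" "s \<noteq> 0"
  shows "w (r * s) = w r + w s"
proof -
  obtain p q where 1: "r = Fract p q" "p \<noteq> 0" "q \<noteq> 0" using fract_cases assms by blast
  obtain p' q' where 2: "s = Fract p' q'" "p' \<noteq> 0" "q' \<noteq> 0" using fract_cases assms by blast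
  show ?thesis using 1 2 by (simp add: rat_val_Fract mult)
qed

lemma rat_val_uminus: "r \<noteq> 0 \<Longrightarrow> w (- r) = w r"
proof -
  assume r: "r \<noteq> 0"
  have "to_fract [:-1::complex:] = -1"
    by (metis to_fract_1 to_fract_uminus one_pCons minus_pCons minus_zero)
  then have "- r = to_fract [:-1:] * r" by simp
  moreover have "w (to_fract [:-1:]) = 0"
    by (subst rat_val_to_fract) (auto intro: const)
  ultimately show ?thesis using r by (simp add: rat_val_mult)
qed

lemma rat_val_square: "r \<noteq> 0 \<Longrightarrow> w (r\<^sup>2) = 2 * w r"
  by (simp add: power2_eq_square rat_val_mult)

text \<open>
  Stating the ultrametric inequality with a lower bound \<open>n\<close> treats the zero function as having
  infinite value, so that sums in which a summand vanishes need no separate statement.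
\<close>

lemma rat_val_add:
  assumes "r + s \<noteq> 0" "r \<noteq> 0 \<Longrightarrow> n \<le> w r" "s \<noteq> 0 \<Longrightarrow> n \<le> w s"
  shows "n \<le> w (r + s)"
proof (cases "r = 0 \<or> s = 0")
  case False
  obtain p q where 1: "r = Fract p q" "p \<noteq> 0" "q \<noteq> 0" using fract_cases False by blast
  obtain p' q' where 2: "s = Fract p' q'" "p' \<noteq> 0" "q' \<noteq> 0" using fract_cases False by blast
  have sum: "r + s = Fract (p * q' + p' * q) (q * q')" using 1 2 by simp
  then have nz: "p * q' + p' * q \<noteq> 0" using assms(1) by (metis fract_collapse(1))
  have "min (d (p * q')) (d (p' * q)) \<le> d (p * q' + p' * q)"
    using 1 2 nz by (intro add) auto
  moreover have "n \<le> d p - d q" "n \<le> d p' - d q'"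
    using assms(2,3) False 1 2 by (auto simp: rat_val_Fract)
  moreover have "w (r + s) = d (p * q' + p' * q) - (d q + d q')"
    using 1 2 nz by (simp add: sum rat_val_Fract mult)
  ultimately show ?thesis using 1 2 by (simp add: mult)
qed (use assms in auto)

lemma rat_val_add_eq:
  assumes "r \<noteq> 0" "s \<noteq> 0" "w r \<noteq> w s"
  shows "r + s \<noteq> 0" "w (r + s) = min (w r) (w s)"
proof -
  show nz: "r + s \<noteq> 0"
  proof
    assume "r + s = 0"
    then have "s = - r" by (simp add: eq_neg_iff_add_eq_0 add.commute)
    with assms show False by (simp add: rat_val_uminus)
  qed
  have ge: "min (w r) (w s) \<le> w (r + s)" using nz by (intro rat_val_add) auto
  have "min (w (r + s)) (w (- s)) \<le> w ((r + s) + (- s))"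
    using assms nz by (rule_tac rat_val_add) auto
  moreover have "min (w (r + s)) (w (- r)) \<le> w ((r + s) + (- r))"
    using assms nz by (rule_tac rat_val_add) auto
  ultimately have "min (w (r + s)) (w s) \<le> w r" "min (w (r + s)) (w r) \<le> w s"
    using assms by (simp_all add: rat_val_uminus)
  with ge assms(3) show "w (r + s) = min (w r) (w s)" by linarith
qed

end

lemma poly_valuation_order: "poly_valuation (\<lambda>p. int (order a p))"
proof
  fix p q :: "complex poly" assume "p \<noteq> 0" "q \<noteq> 0"
  then show "int (order a (p * q)) = int (order a p) + int (order a q)"
    by (simp add: order_mult)
next
  fix p q :: "complex poly" assume nz: "p \<noteq> 0" "q \<noteq> 0" "p + q \<noteq> 0"
  have "[:-a, 1:] ^ min (order a p) (order a q) dvd p + q"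
    by (intro dvd_add) (simp_all add: order_divides)
  then show "min (int (order a p)) (int (order a q)) \<le> int (order a (p + q))"
    using nz by (auto simp: order_divides)
next
  fix c :: complex assume "c \<noteq> 0" then show "int (order a [:c:]) = 0" by (simp add: order_0I)
next
  show "\<exists>t. t \<noteq> 0 \<and> \<bar>int (order a t)\<bar> = 1"
    using order_power_n_n[of a 1] by (intro exI[of _ "[:-a, 1:]"]) auto
qed

lemma poly_valuation_degree: "poly_valuation (\<lambda>p. - int (degree p))"
proof
  fix p q :: "complex poly" assume "p \<noteq> 0" "q \<noteq> 0"
  then show "- int (degree (p * q)) = - int (degree p) + - int (degree q)"
    by (simp add: degree_mult_eq)
next
  fix p q :: "complex poly"
  show "min (- int (degree p)) (- int (degree q)) \<le> - int (degree (p + q))"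
    using degree_add_le_max[of p q] by linarith
next
  show "\<exists>t::complex poly. t \<noteq> 0 \<and> \<bar>- int (degree t)\<bar> = 1"
    by (intro exI[of _ "[:0, 1:]"]) auto
qed auto

section \<open>The point of the curve over a branch point\<close>

text \<open>The norm from the function field of the curve down to \<open>\<complex>(x)\<close>.\<close>

definition curve_norm :: "complex poly \<Rightarrow> curvefun \<Rightarrow> ratfun" where
  "curve_norm f g = (fst g)\<^sup>2 - (snd g)\<^sup>2 * to_fract f"

lemma curve_norm_cmult: "curve_norm f (cmult f g h) = curve_norm f g * curve_norm f h"
  by (simp add: curve_norm_def cmult_def algebra_simps power2_eq_square)

text \<open>
  Over a branch point of \<open>x\<close> there is a single point, with residue field \<open>\<complex>\<close>; its valuation is
  therefore the valuation downstairs composed with the norm.  Multiplicativity comes for free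
  from this description, while the ultrametric inequality is read off from the formula
  \<open>min (2 w(a)) (2 w(b) + d(f))\<close> for the value of \<open>a + b y\<close>.
\<close>

definition place :: "(complex poly \<Rightarrow> int) \<Rightarrow> complex poly \<Rightarrow> curvefun \<Rightarrow> int" where
  "place d f g = (if g = 0 then 0 else rat_val d (curve_norm f g))"

lemma le_twice_plus_iff:
  fixes n m :: int
  shows "n \<le> 2 * m + c \<longleftrightarrow> (n - c + 1) div 2 \<le> m"
  by presburger

text \<open>
  Since \<open>y\<^sup>2 = f\<close>, an odd value \<open>d f\<close> would give \<open>y\<close> a half-integral value; so the valuations
  of \<open>\<complex>(x)\<close> are doubled on the curve, that is, the point is ramified.
\<close>

locale ramified_place = poly_valuation +
  fixes f :: "complex poly"
  assumes odd: "odd (d f)"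
    and f_nonzero: "f \<noteq> 0"
begin

text \<open>
  The squares of \<open>a\<close> and of \<open>b y\<close> have values of different parity, so no cancellation between
  the two parts of \<open>a + b y\<close> can occur.  This is used both for the existence of the place and
  for its uniqueness, and again for the vanishing orders.
\<close>

lemma parity: "2 * w a \<noteq> 2 * w b + d f"
  using odd by presburger

lemma rat_val_norm_snd:
  assumes "b \<noteq> 0"
  shows "w (- (b\<^sup>2 * to_fract f)) = 2 * w b + d f"
  using assms f_nonzero by (simp add: rat_val_uminus rat_val_mult rat_val_square rat_val_to_fract)

lemma curve_norm_nonzero: "g \<noteq> 0 \<Longrightarrow> curve_norm f g \<noteq> 0"
proof -
  obtain a b where g: "g = (a, b)" by (cases g)
  assume nz: "g \<noteq> 0"
  show ?thesis
  proof (cases "a = 0 \<or> b = 0")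
    case True
    then show ?thesis using nz f_nonzero by (auto simp: curve_norm_def g zero_prod_def)
  next
    case False
    have "a\<^sup>2 + - (b\<^sup>2 * to_fract f) \<noteq> 0"
      using False f_nonzero parity[of a b] by (intro rat_val_add_eq) (auto simp: rat_val_norm_snd rat_val_square)
    then show ?thesis by (simp add: curve_norm_def g)
  qed
qed

lemma place_fst: "a \<noteq> 0 \<Longrightarrow> place d f (a, 0) = 2 * w a"
  by (simp add: place_def zero_prod_def curve_norm_def rat_val_square)

lemma place_snd: "b \<noteq> 0 \<Longrightarrow> place d f (0, b) = 2 * w b + d f"
  by (simp add: place_def zero_prod_def curve_norm_def rat_val_norm_snd)

lemma place_both:
  assumes "a \<noteq> 0" "b \<noteq> 0"
  shows "place d f (a, b) = min (2 * w a) (2 * w b + d f)"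
proof -
  have "w (a\<^sup>2 + - (b\<^sup>2 * to_fract f)) = min (w (a\<^sup>2)) (w (- (b\<^sup>2 * to_fract f)))"
    using assms f_nonzero parity[of a b] by (intro rat_val_add_eq) (auto simp: rat_val_norm_snd rat_val_square)
  with assms show ?thesis
    by (simp add: place_def zero_prod_def curve_norm_def rat_val_norm_snd rat_val_square)
qed

lemma le_place_iff:
  assumes "g \<noteq> 0"
  shows "n \<le> place d f g \<longleftrightarrow>
    (fst g \<noteq> 0 \<longrightarrow> n \<le> 2 * w (fst g)) \<and> (snd g \<noteq> 0 \<longrightarrow> n \<le> 2 * w (snd g) + d f)"
  using assms by (cases g; cases "fst g = 0"; cases "snd g = 0")
    (auto simp: place_fst place_snd place_both zero_prod_def)

lemma discrete_valuation_place: "discrete_valuation f (place d f)"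
  unfolding discrete_valuation_def
proof (intro conjI allI impI)
  fix g h :: curvefun assume nz: "g \<noteq> 0" "h \<noteq> 0"
  have "curve_norm f (cmult f g h) \<noteq> 0"
    using nz curve_norm_nonzero by (simp add: curve_norm_cmult)
  then have "cmult f g h \<noteq> 0" by (auto simp: curve_norm_def)
  then show "place d f (cmult f g h) = place d f g + place d f h"
    using nz curve_norm_nonzero by (simp add: place_def curve_norm_cmult rat_val_mult)
next
  fix g h :: curvefun assume nz: "g \<noteq> 0" "h \<noteq> 0" "g + h \<noteq> 0"
  define n where "n = min (place d f g) (place d f h)"
  have g: "n \<le> place d f g" and h: "n \<le> place d f h" by (auto simp: n_def)
  \<comment> \<open>It suffices to bound both components below; halving the bound reduces each to \<open>\<complex>(x)\<close>.\<close>
  have "n \<le> 2 * w (fst g + fst h)" if "fst g + fst h \<noteq> 0"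
  proof -
    have "(n + 1) div 2 \<le> w (fst g + fst h)"
      using g h nz that le_twice_plus_iff[of n _ 0] by (intro rat_val_add) (auto simp: le_place_iff)
    then show ?thesis by simp
  qed
  moreover have "n \<le> 2 * w (snd g + snd h) + d f" if "snd g + snd h \<noteq> 0"
  proof -
    have "(n - d f + 1) div 2 \<le> w (snd g + snd h)"
      using g h nz that le_twice_plus_iff[of n _ "d f"] by (intro rat_val_add) (auto simp: le_place_iff)
    then show ?thesis using le_twice_plus_iff by blast
  qed
  ultimately show "min (place d f g) (place d f h) \<le> place d f (g + h)"
    using nz by (simp add: le_place_iff flip: n_def)
next
  fix c :: complex assume "c \<noteq> 0"
  then show "place d f (cconst c) = 0" by (simp add: cconst_def place_fst rat_val_to_fract const)
next
  obtain t where t: "t \<noteq> 0" "\<bar>d t\<bar> = 1" using uniformizer by blast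
  \<comment> \<open>All integers are values on \<open>\<complex>(x)\<close>; multiplying \<open>y\<close> by a function of value
    \<open>(1 - d f) / 2\<close> gives a uniformizer.\<close>
  have "\<exists>b. b \<noteq> 0 \<and> w b = m" for m :: int
  proof -
    have pow: "s ^ n \<noteq> 0 \<and> w (s ^ n) = int n * w s" if "s \<noteq> 0" for s n
    proof (induction n)
      case 0
      show ?case using rat_val_to_fract[of 1] by (simp add: one)
    next
      case (Suc n)
      then show ?case using that by (simp add: rat_val_mult algebra_simps)
    qed
    have inv: "w (inverse s) = - w s" if "s \<noteq> 0" for s
      using rat_val_mult[of s "inverse s"] that rat_val_to_fract[of 1] by (simp add: one)
    define s where "s = (if 0 \<le> m * d t then to_fract t else inverse (to_fract t))"
    have "s \<noteq> 0" "\<bar>m\<bar> * w s = m"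
      using t inv by (auto simp: s_def rat_val_to_fract abs_if zero_le_mult_iff split: if_splits)
    then show ?thesis using pow[of s "nat \<bar>m\<bar>"] by (metis int_nat_eq abs_ge_zero)
  qed
  then obtain b where b: "b \<noteq> 0" "w b = (1 - d f) div 2" by blast
  have "place d f (0, b) = 1" using b odd by (simp add: place_snd)
  then show "\<exists>g. g \<noteq> 0 \<and> place d f g = 1" using b by (metis prod.inject zero_prod_def)
next
  show "place d f 0 = 0" by (simp add: place_def)
qed

end

section \<open>Discrete valuations of the function field\<close>

abbreviation cpoly :: "complex poly \<Rightarrow> curvefun" where
  "cpoly p \<equiv> (to_fract p, 0)"

lemma cpoly_add: "cpoly (p + q) = cpoly p + cpoly q"
  by simp

lemma cpoly_eq_0: "cpoly p = 0 \<longleftrightarrow> p = 0"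
  by (simp add: zero_prod_def)

lemma funX_minus_cconst: "funX - cconst a = cpoly [:-a, 1:]"
proof -
  have "[:-a, 1:] = [:0, 1:] - [:a:]" by simp
  then have "to_fract [:-a, 1:] = to_fract [:0, 1:] - to_fract [:a:]" by (metis to_fract_diff)
  then show ?thesis by (simp add: funX_def ratX_def cconst_def)
qed

lemma has_value_funX: "has_value v funX (Some a) \<longleftrightarrow> v (cpoly [:-a, 1:]) > 0"
proof -
  have "funX \<noteq> cconst a"
  proof
    assume "funX = cconst a"
    then have "cpoly [:-a, 1:] = 0" by (simp flip: funX_minus_cconst)
    then show False by (simp add: zero_prod_def)
  qed
  then show ?thesis by (simp add: has_value_def funX_minus_cconst)
qed

lemma has_value_funX_infinity: "has_value v funX None \<longleftrightarrow> v (cpoly [:0, 1:]) < 0"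
  by (simp add: has_value_def funX_def ratX_def zero_prod_def)

locale curve_valuation =
  fixes f :: "complex poly" and v :: point
  assumes dv: "discrete_valuation f v"
begin

lemma val_mult: "g \<noteq> 0 \<Longrightarrow> h \<noteq> 0 \<Longrightarrow> v (cmult f g h) = v g + v h"
  and val_add: "g \<noteq> 0 \<Longrightarrow> h \<noteq> 0 \<Longrightarrow> g + h \<noteq> 0 \<Longrightarrow> min (v g) (v h) \<le> v (g + h)"
  and val_const: "c \<noteq> 0 \<Longrightarrow> v (cpoly [:c:]) = 0"
  and val_uniformizer: "\<exists>g. g \<noteq> 0 \<and> v g = 1"
  and val_0: "v 0 = 0"
  using dv unfolding discrete_valuation_def cconst_def by blast+

lemma val_fst_mult: "r \<noteq> 0 \<Longrightarrow> s \<noteq> 0 \<Longrightarrow> v (r * s, 0) = v (r, 0) + v (s, 0)"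
  using val_mult[of "(r, 0)" "(s, 0)"] by (simp add: cmult_def zero_prod_def)

lemma val_poly_mult: "p \<noteq> 0 \<Longrightarrow> q \<noteq> 0 \<Longrightarrow> v (cpoly (p * q)) = v (cpoly p) + v (cpoly q)"
  using val_fst_mult[of "to_fract p" "to_fract q"] by simp

lemma val_uminus: "v (- g) = v g"
proof (cases "g = 0")
  case False
  have "to_fract [:-1::complex:] = -1"
    by (metis to_fract_1 to_fract_uminus one_pCons minus_pCons minus_zero)
  then have "cmult f (cpoly [:-1:]) g = - g" by (simp add: cmult_def prod_eq_iff)
  then show ?thesis using False val_mult[of "cpoly [:-1:]" g] val_const[of "-1"]
    by (simp add: zero_prod_def)
qed simp

lemma val_add_eq:
  assumes "g \<noteq> 0" "h \<noteq> 0" "v g \<noteq> v h"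
  shows "v (g + h) = min (v g) (v h)"
proof -
  have nz: "g + h \<noteq> 0"
  proof
    assume "g + h = 0"
    then have "h = - g" by (simp add: eq_neg_iff_add_eq_0 add.commute)
    with assms show False by (simp add: val_uminus)
  qed
  have "min (v g) (v h) \<le> v (g + h)" using assms nz by (simp add: val_add)
  moreover have "min (v (g + h)) (v h) \<le> v g"
    using val_add[of "g + h" "- h"] assms nz by (simp add: val_uminus)
  moreover have "min (v (g + h)) (v g) \<le> v h"
    using val_add[of "g + h" "- g"] assms nz by (simp add: val_uminus)
  ultimately show ?thesis using assms(3) by linarith
qed

lemma val_poly_add:
  assumes "p \<noteq> 0" "q \<noteq> 0" "p + q \<noteq> 0"
  shows "min (v (cpoly p)) (v (cpoly q)) \<le> v (cpoly (p + q))"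
  unfolding cpoly_add
proof (rule val_add)
  show "cpoly p + cpoly q \<noteq> 0" using assms(3) cpoly_eq_0 cpoly_add by metis
qed (use assms cpoly_eq_0 in auto)

lemma val_poly_add_eq:
  assumes "p \<noteq> 0" "q \<noteq> 0" "v (cpoly p) \<noteq> v (cpoly q)"
  shows "v (cpoly (p + q)) = min (v (cpoly p)) (v (cpoly q))"
  unfolding cpoly_add using assms cpoly_eq_0 by (intro val_add_eq) auto

lemma pCons_split: "pCons c p = [:c:] + [:0, 1:] * p" for p :: "complex poly"
  by simp

lemma val_X_nonneg:
  assumes "has_value v funX (Some a)"
  shows "v (cpoly [:0, 1:]) \<ge> 0"
proof (cases "a = 0")
  case False
  then have "min (v (cpoly [:-a, 1:])) (v (cpoly [:a:])) \<le> v (cpoly [:0, 1:])"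
    using val_poly_add[of "[:-a, 1:]" "[:a:]"] by simp
  then show ?thesis using assms False by (simp add: has_value_funX val_const)
qed (use assms in \<open>simp add: has_value_funX\<close>)

lemma val_poly_nonneg:
  assumes "v (cpoly [:0, 1:]) \<ge> 0"
  shows "p \<noteq> 0 \<Longrightarrow> v (cpoly p) \<ge> 0"
proof (induction p)
  case (pCons c p)
  have X: "v (cpoly ([:0, 1:] * p)) \<ge> 0" if "p \<noteq> 0"
    using that pCons assms val_poly_mult[of "[:0, 1:]" p] by simp
  consider "c = 0" "p \<noteq> 0" | "c \<noteq> 0" "p = 0" | "c \<noteq> 0" "p \<noteq> 0" using pCons by fastforce
  then show ?case
  proof cases
    case 1 then show ?thesis using X by simp
  next
    case 2 then show ?thesis by (simp add: val_const)
  next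
    case 3
    have "min (v (cpoly [:c:])) (v (cpoly ([:0, 1:] * p))) \<le> v (cpoly (pCons c p))"
      using val_poly_add[of "[:c:]" "[:0, 1:] * p"] 3 by (simp only: pCons_split[of c p]) simp
    then show ?thesis using X 3 val_const[of c] by linarith
  qed
qed simp

text \<open>
  A polynomial not vanishing at \<open>a\<close> is a nonzero constant plus a multiple of \<open>x - a\<close>, hence a unit
  at \<open>v\<close>.  So \<open>v\<close> only sees the power of \<open>x - a\<close>.
\<close>

lemma val_poly_at:
  assumes "has_value v funX (Some a)" "p \<noteq> 0"
  shows "v (cpoly p) = v (cpoly [:-a, 1:]) * int (order a p)"
proof -
  let ?e = "v (cpoly [:-a, 1:])"
  note nonneg = val_poly_nonneg[OF val_X_nonneg[OF assms(1)]]
  have e: "?e > 0" using assms(1) by (simp add: has_value_funX)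
  have pow: "v (cpoly ([:-a, 1:] ^ n)) = ?e * int n" for n
  proof (induction n)
    case 0 show ?case using val_const[of 1] by (simp add: one_pCons)
  next
    case (Suc n)
    then show ?case using val_poly_mult[of "[:-a, 1:]" "[:-a, 1:] ^ n"] by (simp add: algebra_simps)
  qed
  have unit: "v (cpoly q) = 0" if q: "poly q a \<noteq> 0" for q
  proof (cases "q = [:poly q a:]")
    case True then show ?thesis using q val_const by metis
  next
    case False
    have "[:-a, 1:] dvd q - [:poly q a:]" by (simp add: dvd_iff_poly_eq_0)
    then obtain s where s: "q - [:poly q a:] = [:-a, 1:] * s" by (elim dvdE)
    with False have "s \<noteq> 0" by auto
    then have pos: "v (cpoly ([:-a, 1:] * s)) > 0"
      using e nonneg[of s] val_poly_mult[of "[:-a, 1:]" s] by simp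
    have "q = [:poly q a:] + [:-a, 1:] * s" using s by (metis add.commute diff_add_cancel)
    moreover have "v (cpoly ([:poly q a:] + [:-a, 1:] * s))
        = min (v (cpoly [:poly q a:])) (v (cpoly ([:-a, 1:] * s)))"
    proof (rule val_poly_add_eq)
      show "[:-a, 1:] * s \<noteq> 0" using \<open>s \<noteq> 0\<close> by (metis mult_eq_0_iff pCons_eq_0_iff one_neq_zero)
    qed (use q pos val_const[OF q] in auto)
    ultimately show ?thesis using pos val_const[OF q] by simp
  qed
  obtain q where q: "p = [:-a, 1:] ^ order a p * q" "\<not> [:-a, 1:] dvd q"
    using order_decomp assms by blast
  then have "q \<noteq> 0" "poly q a \<noteq> 0" by (auto simp: dvd_iff_poly_eq_0)
  then show ?thesis
    using pow unit val_poly_mult[of "[:-a, 1:] ^ order a p" q] q(1) by simp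
qed

text \<open>
  If \<open>x\<close> has a pole at \<open>v\<close>, the leading term of a polynomial dominates all others.
\<close>

lemma val_poly_infinity:
  assumes "has_value v funX None"
  shows "p \<noteq> 0 \<Longrightarrow> v (cpoly p) = - v (cpoly [:0, 1:]) * - int (degree p)"
proof (induction p)
  case (pCons c p)
  have neg: "v (cpoly [:0, 1:]) < 0" using assms by (simp add: has_value_funX_infinity)
  have X: "v (cpoly ([:0, 1:] * p)) = - v (cpoly [:0, 1:]) * - int (Suc (degree p))" if "p \<noteq> 0"
    using that pCons val_poly_mult[of "[:0, 1:]" p] by (simp add: algebra_simps)
  consider "c = 0" "p \<noteq> 0" | "c \<noteq> 0" "p = 0" | "c \<noteq> 0" "p \<noteq> 0" using pCons by fastforce
  then show ?case
  proof cases
    case 1 then show ?thesis using X by simp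
  next
    case 2 then show ?thesis by (simp add: val_const)
  next
    case 3
    have "v (cpoly [:0, 1:]) * int (Suc (degree p)) < 0" using neg by (intro mult_neg_pos) auto
    then have "v (cpoly ([:0, 1:] * p)) < 0" using X 3 by (simp only: minus_mult_minus) simp
    moreover have "v (cpoly ([:c:] + [:0, 1:] * p)) = min (v (cpoly [:c:])) (v (cpoly ([:0, 1:] * p)))"
    proof (rule val_poly_add_eq)
      show "v (cpoly [:c:]) \<noteq> v (cpoly ([:0, 1:] * p))" using calculation val_const[of c] 3 by linarith
    qed (use 3 in auto)
    ultimately have "v (cpoly ([:c:] + [:0, 1:] * p)) = v (cpoly ([:0, 1:] * p))"
      using 3 val_const[of c] by linarith
    also have "\<dots> = - v (cpoly [:0, 1:]) * - int (degree (pCons c p))"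
      using X 3 by simp
    finally show ?thesis by (simp only: pCons_split[symmetric])
  qed
qed simp

lemma two_val_funY: "f \<noteq> 0 \<Longrightarrow> 2 * v funY = v (cpoly f)"
  using val_mult[of funY funY] by (simp add: cmult_def funY_def zero_prod_def)

lemma val_snd: "b \<noteq> 0 \<Longrightarrow> v (0, b) = v (b, 0) + v funY"
  using val_mult[of "(b, 0)" funY] by (simp add: cmult_def funY_def zero_prod_def)

lemma val_regular:
  assumes "has_value v funX (Some a)" "f \<noteq> 0" "(to_fract p, to_fract q) \<noteq> (0 :: curvefun)"
  shows "v (to_fract p, to_fract q) \<ge> 0"
proof -
  note nonneg = val_poly_nonneg[OF val_X_nonneg[OF assms(1)]]
  have q: "v (0, to_fract q) \<ge> 0" if "q \<noteq> 0"
    using that nonneg[of q] nonneg[of f] two_val_funY val_snd[of "to_fract q"] assms(2) by simp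
  consider "p = 0" "q \<noteq> 0" | "p \<noteq> 0" "q = 0" | "p \<noteq> 0" "q \<noteq> 0"
    using assms(3) by (auto simp: zero_prod_def)
  then show ?thesis
  proof cases
    case 3
    then have "min (v (cpoly p)) (v (0, to_fract q)) \<le> v (to_fract p, to_fract q)"
      using val_add[of "cpoly p" "(0, to_fract q)"] by (simp add: zero_prod_def)
    then show ?thesis using q nonneg[of p] 3 by linarith
  qed (use q nonneg in auto)
qed

end

text \<open>
  A valuation restricting to \<open>e \<cdot> w\<close> on \<open>\<complex>(x)\<close> satisfies \<open>2 v(y) = e d(f)\<close>.  As \<open>d(f)\<close> is odd,
  \<open>e = 2n\<close> is even, and by parity \<open>v\<close> is \<open>n\<close> times the place constructed above.  Since \<open>v\<close> is
  normalized, \<open>n = 1\<close>.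
\<close>

lemma (in ramified_place) valuation_eq_place:
  assumes dv: "discrete_valuation f v" and e: "e > 0"
    and poly: "\<And>p. p \<noteq> 0 \<Longrightarrow> v (cpoly p) = e * d p"
  shows "v = place d f"
proof -
  interpret curve_valuation f v using dv by unfold_locales
  have rat: "v (r, 0) = e * w r" if "r \<noteq> 0" for r
  proof -
    obtain p q where r: "r = Fract p q" "p \<noteq> 0" "q \<noteq> 0" by (rule fract_cases[OF \<open>r \<noteq> 0\<close>])
    have "v (r * to_fract q, 0) = v (r, 0) + v (cpoly q)"
      using that r(3) by (intro val_fst_mult) simp_all
    moreover have "r * to_fract q = to_fract p"
      using r(3) unfolding r(1) Fract_conv_to_fract by simp
    ultimately have "v (r, 0) + e * d q = e * d p"
      unfolding poly[OF r(3)] using poly[OF r(2)] by (simp only:)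
    then show ?thesis unfolding r(1) rat_val_Fract[OF r(2,3)] right_diff_distrib by linarith
  qed
  have Y: "2 * v funY = e * d f" using two_val_funY poly f_nonzero by simp
  then have "even (e * d f)" by (simp flip: Y)
  then have "even e" using odd by simp
  then obtain n where n: "e = 2 * n" by (elim evenE)
  have n_pos: "n > 0" using n e by simp
  have Y': "v funY = n * d f" using Y n by simp
  have eq: "v g = n * place d f g" for g
  proof -
    obtain a b where g: "g = (a, b)" by (cases g)
    have fst: "v (a, 0) = n * (2 * w a)" if "a \<noteq> 0" using rat that n by simp
    have snd: "v (0, b) = n * (2 * w b + d f)" if "b \<noteq> 0"
      using rat that n val_snd Y' by (simp add: algebra_simps)
    consider "a = 0" "b = 0" | "a = 0" "b \<noteq> 0" | "a \<noteq> 0" "b = 0" | "a \<noteq> 0" "b \<noteq> 0" by blast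
    then show ?thesis
    proof cases
      case 1 then show ?thesis using val_0 by (simp add: g place_def zero_prod_def)
    next
      case 2 then show ?thesis by (simp add: g snd place_snd)
    next
      case 3 then show ?thesis by (simp add: g fst place_fst)
    next
      case 4
      then have "v (a, 0) \<noteq> v (0, b)" using fst snd parity[of a b] n_pos by simp
      then have "v ((a, 0) + (0, b)) = min (v (a, 0)) (v (0, b))"
        using 4 by (intro val_add_eq) (auto simp: zero_prod_def)
      then show ?thesis using 4 n_pos by (simp add: g fst snd place_both min_def)
    qed
  qed
  obtain g where "v g = 1" using val_uniformizer by blast
  then have "n dvd 1" using dvd_triv_left[of n "place d f g"] by (simp flip: eq)
  then have "n = 1" using n_pos by simp
  then show ?thesis using eq by (intro ext) simp
qed

section \<open>The marked points\<close>

abbreviation place_at :: "complex poly \<Rightarrow> complex \<Rightarrow> point" where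
  "place_at f a \<equiv> place (\<lambda>p. int (order a p)) f"

abbreviation place_infinity :: "complex poly \<Rightarrow> point" where
  "place_infinity f \<equiv> place (\<lambda>p. - int (degree p)) f"

lemma normalization_discrete_valuation: "v \<in> normalization f \<Longrightarrow> discrete_valuation f v"
  by (simp add: normalization_def)

lemma ramified_place_at:
  assumes "odd (order a f)" "f \<noteq> 0"
  shows "ramified_place (\<lambda>p. int (order a p)) f"
  using poly_valuation_order assms by (simp add: ramified_place_def ramified_place_axioms_def)

lemma ramified_place_infinity:
  assumes "odd (degree f)"
  shows "ramified_place (\<lambda>p. - int (degree p)) f"
  using poly_valuation_degree assms by (auto simp: ramified_place_def ramified_place_axioms_def)

lemma eq_place_at:
  assumes "odd (order a f)" "f \<noteq> 0" "discrete_valuation f v" "has_value v funX (Some a)"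
  shows "v = place_at f a"
proof -
  interpret ramified_place "\<lambda>p. int (order a p)" f by (rule ramified_place_at) fact+
  interpret curve_valuation f v by unfold_locales fact
  show ?thesis
    using val_poly_at[OF assms(4)] assms(4)
    by (intro valuation_eq_place[OF assms(3)]) (simp_all only: has_value_funX)
qed

lemma eq_place_infinity:
  assumes "odd (degree f)" "discrete_valuation f v" "has_value v funX None"
  shows "v = place_infinity f"
proof -
  interpret ramified_place "\<lambda>p. - int (degree p)" f by (rule ramified_place_infinity) fact
  interpret curve_valuation f v by unfold_locales fact
  show ?thesis
  proof (rule valuation_eq_place[OF assms(2)])
    show "- v (cpoly [:0, 1:]) > 0" using assms(3) by (simp add: has_value_funX_infinity)
  qed (rule val_poly_infinity[OF assms(3)])
qed

lemma place_at_lies_over: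
  assumes "odd (order a f)" "f \<noteq> 0"
  shows "place_at f a \<in> normalization f" "lies_over (place_at f a) (Some a, Some 0)"
proof -
  interpret ramified_place "\<lambda>p. int (order a p)" f by (rule ramified_place_at) fact+
  have X: "has_value (place_at f a) funX (Some a)"
    using order_power_n_n[of a 1] by (simp add: has_value_funX place_fst rat_val_to_fract)
  have ord: "order a f > 0" using assms(1) by (cases "order a f") auto
  have "place_at f a funY > 0"
    using ord place_snd[of 1] rat_val_to_fract[of 1] one by (simp add: funY_def)
  then have Y: "has_value (place_at f a) funY (Some 0)"
    by (simp add: has_value_def cconst_def flip: zero_prod_def)
  show lo: "lies_over (place_at f a) (Some a, Some 0)" using X Y by (simp add: lies_over_def)
  have "poly f a = 0" using ord by (simp add: order_root)
  then have "(Some a, Some 0) \<in> compactification f"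
    unfolding compactification_def mem_Collect_eq split_conv
    by (intro exI[of _ "\<lambda>_. a"] exI[of _ "\<lambda>_. 0"]) (simp add: tendsto_P1_def)
  then show "place_at f a \<in> normalization f"
    using lo discrete_valuation_place by (auto simp: normalization_def)
qed

text \<open>
  The sequence \<open>(n, sqrt (f n))\<close> runs along the affine curve towards \<open>(\<infinity>, \<infinity>)\<close>.
\<close>

lemma infinity_in_compactification:
  assumes "degree f > 0"
  shows "(None, None) \<in> compactification f"
proof -
  define s :: "nat \<Rightarrow> complex" where "s n = of_nat n" for n
  define t where "t n = csqrt (poly f (s n))" for n
  have s: "filterlim s at_infinity sequentially"
    unfolding s_def by (rule tendsto_of_nat)
  obtain c p where f: "f = pCons c p" by (cases f)
  then have "p \<noteq> 0" using assms by auto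
  have "filterlim t at_infinity sequentially"
    unfolding filterlim_at_infinity[OF order_refl]
  proof (intro allI impI)
    fix r :: real
    obtain R where R: "\<And>z. R \<le> norm z \<Longrightarrow> \<bar>r\<bar>\<^sup>2 \<le> norm (poly f z)"
      using poly_infinity[OF \<open>p \<noteq> 0\<close>] f by blast
    have "\<forall>\<^sub>F n in sequentially. R \<le> real n"
      using filterlim_real_sequentially by (simp add: filterlim_at_top)
    then show "\<forall>\<^sub>F n in sequentially. r \<le> norm (t n)"
    proof eventually_elim
      case (elim n)
      have "\<bar>r\<bar>\<^sup>2 \<le> norm (t n) ^ 2"
        using R[of "s n"] elim by (simp add: s_def t_def flip: norm_power)
      then show ?case by (meson abs_ge_self norm_ge_zero order_trans power2_le_imp_le)
    qed
  qed
  moreover have "(t n)\<^sup>2 = poly f (s n)" for n by (simp add: t_def)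
  ultimately show ?thesis using s unfolding compactification_def tendsto_P1_def by auto
qed

lemma place_infinity_lies_over:
  assumes "odd (degree f)"
  shows "place_infinity f \<in> normalization f" "has_value (place_infinity f) funX None"
proof -
  interpret ramified_place "\<lambda>p. - int (degree p)" f by (rule ramified_place_infinity) fact
  show X: "has_value (place_infinity f) funX None"
    by (simp add: has_value_funX_infinity place_fst rat_val_to_fract)
  have deg: "degree f > 0" using assms by (cases "degree f") auto
  have "place_infinity f funY < 0"
    using deg place_snd[of 1] rat_val_to_fract[of 1] one by (simp add: funY_def)
  then have "has_value (place_infinity f) funY None" by (simp add: has_value_def funY_def zero_prod_def)
  then show "place_infinity f \<in> normalization f"
    using X discrete_valuation_place infinity_in_compactification[OF deg]
    by (auto simp: normalization_def lies_over_def intro!: bexI[of _ "(None, None)"])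
qed

section \<open>The series and its complexification\<close>

lemma ratX_power: "ratX ^ i = to_fract (monom 1 i)"
proof (induction i)
  case (Suc i)
  have "[:0, 1:] * monom 1 i = (monom 1 (Suc i) :: complex poly)" by (simp add: monom_Suc)
  with Suc show ?case by (metis power_Suc ratX_def to_fract_mult)
qed simp

lemma scaled_ratX_power: "to_fract [:c:] * ratX ^ i = to_fract (monom c i)"
proof -
  have "[:c:] * monom 1 i = monom c i" by (simp add: smult_monom)
  then show ?thesis by (metis ratX_power to_fract_mult)
qed

definition series_basis :: "nat \<Rightarrow> nat \<Rightarrow> curvefun set" where
  "series_basis n m = (\<lambda>i. (ratX ^ i, 0)) ` {..<n} \<union> (\<lambda>i. (0, ratX ^ i)) ` {..<m}"

text \<open>
  Functions \<open>p(x) + q(x) y\<close> with coefficients in \<open>K\<close>.  The degree bounds are vanishing conditions on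
  coefficients, so that the zero polynomial satisfies them also for the bound \<open>0\<close>.
\<close>

definition poly_pairs :: "complex set \<Rightarrow> nat \<Rightarrow> nat \<Rightarrow> curvefun set" where
  "poly_pairs K n m =
     {(to_fract p, to_fract q) | p q. range (coeff p) \<subseteq> K \<and> range (coeff q) \<subseteq> K \<and>
        (\<forall>i\<ge>n. coeff p i = 0) \<and> (\<forall>i\<ge>m. coeff q i = 0)}"

lemma series_H_eq: "series_H k g = RF.span (series_basis (Suc k) (k - g))"
proof -
  have "{(ratX ^ i, 0) | i. i \<le> k} \<union> {(0, ratX ^ i) | i. i < k - g} = series_basis (Suc k) (k - g)"
    by (auto simp: series_basis_def less_Suc_eq_le)
  then show ?thesis by (simp add: series_H_def)
qed

lemma poly_pairsI:
  assumes "\<And>i. coeff p i \<in> K" "\<And>i. coeff q i \<in> K"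
    and "\<And>i. i \<ge> n \<Longrightarrow> coeff p i = 0" "\<And>i. i \<ge> m \<Longrightarrow> coeff q i = 0"
  shows "(to_fract p, to_fract q) \<in> poly_pairs K n m"
  unfolding poly_pairs_def mem_Collect_eq
  by (intro exI[of _ p] exI[of _ q]) (use assms in \<open>auto simp: image_subset_iff\<close>)

lemma poly_pairsE:
  assumes "x \<in> poly_pairs K n m"
  obtains p q where "x = (to_fract p, to_fract q)" "\<forall>i. coeff p i \<in> K" "\<forall>i. coeff q i \<in> K"
    "\<forall>i\<ge>n. coeff p i = 0" "\<forall>i\<ge>m. coeff q i = 0"
proof -
  obtain p q where "x = (to_fract p, to_fract q)" "range (coeff p) \<subseteq> K" "range (coeff q) \<subseteq> K"
    "\<forall>i\<ge>n. coeff p i = 0" "\<forall>i\<ge>m. coeff q i = 0"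
    using assms by (auto simp: poly_pairs_def)
  then show thesis by (intro that[of p q]) (auto simp: image_subset_iff)
qed

lemma poly_pairs_add:
  assumes "x \<in> poly_pairs K n m" "y \<in> poly_pairs K n m" "\<And>a b. a \<in> K \<Longrightarrow> b \<in> K \<Longrightarrow> a + b \<in> K"
  shows "x + y \<in> poly_pairs K n m"
proof -
  obtain p q where x: "x = (to_fract p, to_fract q)" "\<forall>i. coeff p i \<in> K" "\<forall>i. coeff q i \<in> K"
    "\<forall>i\<ge>n. coeff p i = 0" "\<forall>i\<ge>m. coeff q i = 0"
    using assms(1) by (rule poly_pairsE) blast
  obtain p' q' where y: "y = (to_fract p', to_fract q')" "\<forall>i. coeff p' i \<in> K" "\<forall>i. coeff q' i \<in> K"
    "\<forall>i\<ge>n. coeff p' i = 0" "\<forall>i\<ge>m. coeff q' i = 0"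
    using assms(2) by (rule poly_pairsE) blast
  have "(to_fract (p + p'), to_fract (q + q')) \<in> poly_pairs K n m"
    using x(2-) y(2-) assms(3) by (intro poly_pairsI) simp_all
  then show ?thesis by (simp add: x(1) y(1))
qed

lemma poly_pairs_scale:
  assumes "x \<in> poly_pairs K n m" "c \<in> K" "\<And>a b. a \<in> K \<Longrightarrow> b \<in> K \<Longrightarrow> a * b \<in> K"
  shows "cscale c x \<in> poly_pairs K n m"
proof -
  obtain p q where x: "x = (to_fract p, to_fract q)" "\<forall>i. coeff p i \<in> K" "\<forall>i. coeff q i \<in> K"
    "\<forall>i\<ge>n. coeff p i = 0" "\<forall>i\<ge>m. coeff q i = 0"
    using assms(1) by (rule poly_pairsE) blast
  have "to_fract [:c:] * to_fract r = to_fract (smult c r)" for r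
    using to_fract_mult[of "[:c:]" r] by simp
  moreover have "(to_fract (smult c p), to_fract (smult c q)) \<in> poly_pairs K n m"
    using x(2-) assms(2,3) by (intro poly_pairsI) simp_all
  ultimately show ?thesis by (simp add: x(1) cscale_def)
qed

lemma poly_pairs_0: "0 \<in> K \<Longrightarrow> 0 \<in> poly_pairs K n m"
  using poly_pairsI[of 0 K 0 n m] by (simp add: zero_prod_def)

lemma series_basis_subset: "0 \<in> K \<Longrightarrow> 1 \<in> K \<Longrightarrow> series_basis n m \<subseteq> poly_pairs K n m"
proof
  fix x assume K: "0 \<in> K" "1 \<in> K" and "x \<in> series_basis n m"
  then consider i where "i < n" "x = (to_fract (monom 1 i), to_fract 0)"
    | i where "i < m" "x = (to_fract 0, to_fract (monom 1 i))"
    by (auto simp: series_basis_def ratX_power)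
  then show "x \<in> poly_pairs K n m"
    by cases (use K in \<open>auto intro!: poly_pairsI simp del: to_fract_0\<close>)
qed

lemma poly_eq_sum_monom: "\<forall>i\<ge>n. coeff p i = 0 \<Longrightarrow> p = (\<Sum>i<n. monom (coeff p i) i)"
  by (rule poly_eqI) (auto simp: coeff_sum not_less)

lemma sum_scaled_basis:
  "(\<Sum>i<n. cscale (a i) (ratX ^ i, 0)) + (\<Sum>i<m. cscale (b i) (0, ratX ^ i))
    = (to_fract (\<Sum>i<n. monom (a i) i), to_fract (\<Sum>i<m. monom (b i) i))"
  by (simp add: prod_eq_iff fst_sum snd_sum cscale_def scaled_ratX_power)

text \<open>
  Expanding \<open>p\<close> and \<open>q\<close> in monomials exhibits \<open>p(x) + q(x) y\<close> as a complex combination of the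
  generators; conversely, the right hand side is closed under real and complex combinations.
\<close>

lemma CF_span_series_H: "CF.span (series_H k g) = poly_pairs UNIV (Suc k) (k - g)"
proof
  let ?B = "series_basis (Suc k) (k - g)"
  have "RF.subspace (poly_pairs UNIV (Suc k) (k - g))"
    by (auto intro!: RF.subspaceI poly_pairs_add poly_pairs_scale poly_pairs_0 simp: rscale_def)
  then have "series_H k g \<subseteq> poly_pairs UNIV (Suc k) (k - g)"
    unfolding series_H_eq by (intro RF.span_minimal series_basis_subset) auto
  moreover have "CF.subspace (poly_pairs UNIV (Suc k) (k - g))"
    by (auto intro!: CF.subspaceI poly_pairs_add poly_pairs_scale poly_pairs_0)
  ultimately show "CF.span (series_H k g) \<subseteq> poly_pairs UNIV (Suc k) (k - g)"
    by (rule CF.span_minimal)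
  show "poly_pairs UNIV (Suc k) (k - g) \<subseteq> CF.span (series_H k g)"
  proof
    fix x assume "x \<in> poly_pairs UNIV (Suc k) (k - g)"
    then obtain p q where x: "x = (to_fract p, to_fract q)"
      "\<forall>i\<ge>Suc k. coeff p i = 0" "\<forall>i\<ge>k - g. coeff q i = 0" by (auto simp: poly_pairs_def)
    have "x = (\<Sum>i<Suc k. cscale (coeff p i) (ratX ^ i, 0)) + (\<Sum>i<k - g. cscale (coeff q i) (0, ratX ^ i))"
      unfolding sum_scaled_basis x(1) using poly_eq_sum_monom[OF x(2)] poly_eq_sum_monom[OF x(3)] by metis
    also have "\<dots> \<in> CF.span ?B"
      by (intro CF.span_add CF.span_sum CF.span_scale CF.span_base) (auto simp: series_basis_def)
    also have "CF.span ?B \<subseteq> CF.span (series_H k g)"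
      unfolding series_H_eq by (intro CF.span_mono RF.span_superset)
    finally show "x \<in> CF.span (series_H k g)" .
  qed
qed

lemma series_basis_independent: "RF.independent (series_basis n m)"
  and card_series_basis: "card (series_basis n m) = n + m"
proof -
  let ?s = "\<lambda>i. (ratX ^ i, 0) :: curvefun" and ?t = "\<lambda>i. (0, ratX ^ i) :: curvefun"
  have inj: "inj_on ?s {..<n}" "inj_on ?t {..<m}"
    by (auto simp: inj_on_def ratX_power) (metis degree_monom_eq one_neq_zero)+
  have disj: "?s ` {..<n} \<inter> ?t ` {..<m} = {}" by (auto simp: ratX_power)
  show "card (series_basis n m) = n + m"
    unfolding series_basis_def using inj disj by (simp add: card_Un_disjoint card_image)
  show "RF.independent (series_basis n m)"
  proof -
    have fin: "finite (series_basis n m)" by (simp add: series_basis_def)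
    have "u x = 0" if u: "(\<Sum>x\<in>series_basis n m. rscale (u x) x) = 0" and x: "x \<in> series_basis n m" for u x
    proof -
      let ?p = "\<Sum>i<n. monom (complex_of_real (u (?s i))) i"
      let ?q = "\<Sum>i<m. monom (complex_of_real (u (?t i))) i"
      have "(\<Sum>x\<in>series_basis n m. rscale (u x) x) = (to_fract ?p, to_fract ?q)"
        unfolding series_basis_def using inj disj
        by (simp add: sum.union_disjoint sum.reindex rscale_def sum_scaled_basis del: to_fract_sum)
      then have "?p = 0" "?q = 0" using u by (simp_all add: zero_prod_def del: to_fract_sum)
      then have pq: "coeff ?p i = 0" "coeff ?q i = 0" for i by simp_all
      have "u (?s i) = 0" if "i < n" for i using pq(1)[of i] that by (simp add: coeff_sum)
      moreover have "u (?t i) = 0" if "i < m" for i using pq(2)[of i] that by (simp add: coeff_sum)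
      ultimately show ?thesis using x by (auto simp: series_basis_def)
    qed
    then show ?thesis using RF.dependent_finite[OF fin] by blast
  qed
qed

lemma series_rank_series_H: "series_rank (series_H k g) = k + (k - g)"
  by (simp add: series_rank_def series_H_eq RF.dim_eq_card_independent[OF series_basis_independent]
      card_series_basis)

section \<open>Vanishing orders and weights\<close>

lemma double_sum_int: "2 * (\<Sum>i<n. int i) = int n * (int n - 1)"
  by (induction n) (auto simp: algebra_simps)

lemma double_choose_two: "2 * int (Suc n choose 2) = int n * (int n + 1)"
  by (induction n) (auto simp: algebra_simps numeral_2_eq_2)

text \<open>
  The even orders and the odd orders are disjoint arithmetic progressions with difference 2, and
  together they are as many as the dimension of the series.  Since the sum of a sorted list is the
  sum of the set of its entries, the weight is a difference of three triangular sums.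
\<close>

lemma inflection_weight_even_odd:
  assumes orders: "vanishing_orders D V P = (\<lambda>i. 2 * int i) ` {..<Suc k} \<union> (\<lambda>i. c + 2 * int i) ` {..<m}"
    and rank: "series_rank V = k + m" and c: "odd c" and m: "m \<le> k"
  shows "inflection_weight D V P = int ((k - m + 1) choose 2) + int m * (c - 1)"
proof -
  define A where "A = (\<lambda>i. 2 * int i) ` {..<Suc k}"
  define B where "B = (\<lambda>i. c + 2 * int i) ` {..<m}"
  have inj: "inj_on (\<lambda>i. 2 * int i) {..<Suc k}" "inj_on (\<lambda>i. c + 2 * int i) {..<m}"
    by (auto simp: inj_on_def)
  have fin: "finite A" "finite B" by (auto simp: A_def B_def)
  have "even x" if "x \<in> A" for x using that by (auto simp: A_def)
  moreover have "odd x" if "x \<in> B" for x using that c by (auto simp: B_def)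
  ultimately have disj: "A \<inter> B = {}" by blast
  let ?L = "sorted_list_of_set (A \<union> B)"
  have "card A = Suc k" "card B = m" unfolding A_def B_def by (simp_all only: card_image inj card_lessThan)
  then have len: "length ?L = Suc (k + m)" using fin disj by (simp add: card_Un_disjoint)
  have ivl: "{0..k + m} = {..<Suc (k + m)}" by auto
  have "inflection_weight D V P = (\<Sum>i<Suc (k + m). ?L ! i - int i)"
    unfolding inflection_weight_def orders rank ivl A_def B_def ..
  also have "\<dots> = sum_list ?L - (\<Sum>i<Suc (k + m). int i)"
    unfolding sum_subtractf sum_list_sum_nth len by (simp add: atLeast0LessThan)
  also have "sum_list ?L = \<Sum> (A \<union> B)"
    using fin by (simp add: distinct_sum_list_conv_Sum)
  also have "\<dots> = \<Sum> A + \<Sum> B" using fin disj by (rule sum.union_disjoint)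
  also have "\<Sum> A = 2 * (\<Sum>i<Suc k. int i)"
    unfolding A_def by (subst sum.reindex[OF inj(1)]) (simp add: sum_distrib_left)
  also have "\<Sum> B = int m * c + 2 * (\<Sum>i<m. int i)"
    unfolding B_def by (subst sum.reindex[OF inj(2)]) (simp add: sum.distrib sum_distrib_left)
  finally have "2 * inflection_weight D V P
      = 2 * (int (Suc k) * (int (Suc k) - 1)) + 2 * (int m * c) + 2 * (int m * (int m - 1))
        - int (Suc (k + m)) * (int (Suc (k + m)) - 1)"
    unfolding double_sum_int[symmetric] by (simp only: algebra_simps)
  also have "\<dots> = 2 * (int ((k - m + 1) choose 2) + int m * (c - 1))"
    using double_choose_two[of "k - m"] m by (simp add: of_nat_diff algebra_simps)
  finally show ?thesis by simp
qed

lemma orders_at: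
  "{int (order a p) | p. p \<noteq> 0 \<and> (\<forall>i\<ge>n. coeff p i = 0)} = int ` {..<n}" for a :: complex
proof (intro equalityI subsetI)
  fix x assume "x \<in> {int (order a p) | p. p \<noteq> 0 \<and> (\<forall>i\<ge>n. coeff p i = 0)}"
  then obtain p where p: "x = int (order a p)" "p \<noteq> 0" "\<forall>i\<ge>n. coeff p i = 0" by blast
  then have "degree p < n" by (metis leading_coeff_0_iff not_less)
  then show "x \<in> int ` {..<n}" using order_degree[OF p(2), of a] p(1) by auto
next
  fix x assume "x \<in> int ` {..<n}"
  then obtain i where "x = int i" "i < n" by auto
  moreover have "\<forall>l\<ge>n. coeff ([:-a, 1:] ^ i) l = 0"
    using \<open>i < n\<close> by (auto intro!: coeff_eq_0 simp: degree_linear_power)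
  ultimately show "x \<in> {int (order a p) | p. p \<noteq> 0 \<and> (\<forall>i\<ge>n. coeff p i = 0)}"
    by (auto simp: order_power_n_n intro!: exI[of _ "[:-a, 1:] ^ i"])
qed

lemma orders_infinity:
  "{- int (degree p) | p :: complex poly. p \<noteq> 0 \<and> (\<forall>i\<ge>n. coeff p i = 0)} = (\<lambda>i. - int i) ` {..<n}"
proof (intro equalityI subsetI)
  fix x assume "x \<in> {- int (degree p) | p :: complex poly. p \<noteq> 0 \<and> (\<forall>i\<ge>n. coeff p i = 0)}"
  then obtain p :: "complex poly" where p: "x = - int (degree p)" "p \<noteq> 0" "\<forall>i\<ge>n. coeff p i = 0" by blast
  then have "degree p < n" by (metis leading_coeff_0_iff not_less)
  then show "x \<in> (\<lambda>i. - int i) ` {..<n}" using p(1) by auto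
next
  fix x assume "x \<in> (\<lambda>i. - int i) ` {..<n}"
  then obtain i where "x = - int i" "i < n" by auto
  then show "x \<in> {- int (degree p) | p :: complex poly. p \<noteq> 0 \<and> (\<forall>i\<ge>n. coeff p i = 0)}"
    by (auto simp: degree_monom_eq intro!: exI[of _ "monom 1 i"])
qed

text \<open>
  By parity a section \<open>p + q y\<close> vanishes to the smaller of the orders of \<open>p\<close> and of \<open>q y\<close>, so the
  orders of the series are those of its elements of one of the two kinds.
\<close>

lemma (in ramified_place) vanishing_orders_series_H:
  "vanishing_orders D (series_H k g) (place d f) =
     (\<lambda>n. 2 * n + D (place d f)) ` {d p | p. p \<noteq> 0 \<and> (\<forall>i\<ge>Suc k. coeff p i = 0)} \<union>
     (\<lambda>n. 2 * n + d f + D (place d f)) ` {d q | q. q \<noteq> 0 \<and> (\<forall>i\<ge>k - g. coeff q i = 0)}"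
  (is "?L = ?R1 \<union> ?R2")
proof (intro equalityI subsetI)
  fix x assume "x \<in> ?L"
  then obtain p q where x: "x = place d f (to_fract p, to_fract q) + D (place d f)"
    and nz: "p \<noteq> 0 \<or> q \<noteq> 0" and p: "\<forall>i\<ge>Suc k. coeff p i = 0" and q: "\<forall>i\<ge>k - g. coeff q i = 0"
    unfolding vanishing_orders_def CF_span_series_H poly_pairs_def by (auto simp: zero_prod_def)
  have "(p \<noteq> 0 \<and> x = 2 * d p + D (place d f)) \<or> (q \<noteq> 0 \<and> x = 2 * d q + d f + D (place d f))"
    using nz x by (cases "p = 0"; cases "q = 0")
      (auto simp: place_fst place_snd place_both rat_val_to_fract min_def)
  then show "x \<in> ?R1 \<union> ?R2" using p q by blast
next
  have mem: "place d f h + D (place d f) \<in> ?L" if "h \<in> CF.span (series_H k g)" "h \<noteq> 0" for h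
    unfolding vanishing_orders_def using that by blast
  fix x assume "x \<in> ?R1 \<union> ?R2"
  then consider p where "x = 2 * d p + D (place d f)" "p \<noteq> 0" "\<forall>i\<ge>Suc k. coeff p i = 0"
    | q where "x = 2 * d q + d f + D (place d f)" "q \<noteq> 0" "\<forall>i\<ge>k - g. coeff q i = 0" by blast
  then show "x \<in> ?L"
  proof cases
    case 1
    then have "(to_fract p, to_fract 0) \<in> CF.span (series_H k g)"
      unfolding CF_span_series_H poly_pairs_def by fastforce
    with 1 show ?thesis using mem[of "cpoly p"] by (simp add: place_fst rat_val_to_fract zero_prod_def)
  next
    case 2
    then have "(to_fract 0, to_fract q) \<in> CF.span (series_H k g)"
      unfolding CF_span_series_H poly_pairs_def by fastforce
    with 2 show ?thesis using mem[of "(0, to_fract q)"]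
      by (simp add: place_snd rat_val_to_fract zero_prod_def)
  qed
qed

section \<open>Real sections and uniqueness of the marked points\<close>

lemma cnj_ratfun_to_fract: "cnj_ratfun (to_fract p) = to_fract (map_poly cnj p)"
  unfolding to_fract_def by (subst cnj_ratfun_Fract) (simp_all add: map_poly_1')

lemma real_curvefun_poly_pairs: "h \<in> poly_pairs \<real> n m \<Longrightarrow> real_curvefun h"
proof (erule poly_pairsE)
  fix p q assume h: "h = (to_fract p, to_fract q)" "\<forall>i. coeff p i \<in> \<real>" "\<forall>i. coeff q i \<in> \<real>"
  then have "map_poly cnj p = p" "map_poly cnj q = q"
    by (simp_all add: poly_eq_iff coeff_map_poly Reals_cnj_iff)
  then show ?thesis by (simp add: real_curvefun_def cnj_curvefun_def cnj_ratfun_to_fract h)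
qed

lemma real_combinations_series: "series_H k g \<subseteq> poly_pairs \<real> (Suc k) (k - g)"
  unfolding series_H_eq
proof (rule RF.span_minimal)
  show "RF.subspace (poly_pairs \<real> (Suc k) (k - g))"
    by (auto intro!: RF.subspaceI poly_pairs_add poly_pairs_scale poly_pairs_0 simp: rscale_def)
qed (simp add: series_basis_subset)

lemma unique_point_at:
  assumes "odd (order a f)" "f \<noteq> 0"
  shows "v \<in> normalization f \<and> has_value v funX (Some a) \<longleftrightarrow> v = place_at f a"
    and "v \<in> normalization f \<and> lies_over v (Some a, Some 0) \<longleftrightarrow> v = place_at f a"
  using eq_place_at[OF assms] place_at_lies_over[OF assms] normalization_discrete_valuation
  by (auto simp: lies_over_def)

lemma unique_point_infinity:
  assumes "odd (degree f)"
  shows "v \<in> normalization f \<and> has_value v funX None \<longleftrightarrow> v = place_infinity f"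
  using eq_place_infinity[OF assms] place_infinity_lies_over[OF assms] normalization_discrete_valuation
  by auto

lemma point_over_x_infinity: "odd (degree f) \<Longrightarrow> point_over_x f None = place_infinity f"
  unfolding point_over_x_def by (simp add: unique_point_infinity)

lemma div_infinity_at:
  assumes "odd (degree f)" "discrete_valuation f v" "has_value v funX (Some a)"
  shows "div_infinity k f v = 0"
proof -
  interpret curve_valuation f v by unfold_locales fact
  have "v \<noteq> place_infinity f"
    using val_X_nonneg[OF assms(3)] place_infinity_lies_over(2)[OF assms(1)]
    by (auto simp: has_value_funX_infinity)
  then show ?thesis by (simp add: div_infinity_def point_divisor_def point_over_x_infinity assms(1))
qed

lemma div_infinity_infinity: "odd (degree f) \<Longrightarrow> div_infinity k f (place_infinity f) = 2 * int k"
  by (simp add: div_infinity_def point_divisor_def point_over_x_infinity)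

text \<open>
  At a point over a finite value of \<open>x\<close> both \<open>x\<close> and \<open>y\<close> are regular.  At infinity \<open>x\<close> has a pole of
  order \<open>2\<close> and \<open>y\<close> one of order \<open>degree f\<close>, so \<open>x\<^sup>i y\<close> with \<open>i < k - g\<close> has a pole of order at most
  \<open>2 (k - g - 1) + (2 g + 1) < 2 k\<close>.
\<close>

lemma series_H_sections:
  assumes f: "odd (degree f)" "degree f \<le> 2 * g + 1" and gk: "g \<le> k"
  shows "series_H k g \<subseteq> real_sections f (div_infinity k f)"
proof
  fix h assume "h \<in> series_H k g"
  then have h: "h \<in> poly_pairs \<real> (Suc k) (k - g)" using real_combinations_series by blast
  have f0: "f \<noteq> 0" using f(1) by auto
  from h obtain p q where pq: "h = (to_fract p, to_fract q)"
    "\<forall>i\<ge>Suc k. coeff p i = 0" "\<forall>i\<ge>k - g. coeff q i = 0" by (rule poly_pairsE) blast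
  have "v h + div_infinity k f v \<ge> 0" if v: "v \<in> normalization f" and nz: "h \<noteq> 0" for v
  proof -
    have dv: "discrete_valuation f v" using v by (rule normalization_discrete_valuation)
    obtain x where x: "has_value v funX x" using v by (auto simp: normalization_def lies_over_def)
    show ?thesis
    proof (cases x)
      case None
      interpret ramified_place "\<lambda>p. - int (degree p)" f by (rule ramified_place_infinity) fact
      have "v = place_infinity f" using eq_place_infinity[OF f(1) dv] x None by simp
      moreover have "- 2 * int k \<le> place_infinity f h"
      proof -
        have "degree p \<le> k" if "p \<noteq> 0"
          using that pq(2) by (metis leading_coeff_0_iff not_less_eq_eq)
        moreover have "degree q < k - g" if "q \<noteq> 0"
          using that pq(3) by (metis leading_coeff_0_iff not_less)
        ultimately show ?thesis
          unfolding le_place_iff[OF nz] unfolding pq(1) using f(2) gk by (auto simp: rat_val_to_fract)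
      qed
      ultimately show ?thesis by (simp add: div_infinity_infinity[OF f(1)])
    next
      case (Some a)
      interpret curve_valuation f v by unfold_locales fact
      have "v h \<ge> 0" using val_regular[of a p q] x Some f0 nz pq(1) by simp
      then show ?thesis using div_infinity_at[OF f(1) dv] x Some by simp
    qed
  qed
  then show "h \<in> real_sections f (div_infinity k f)"
    using real_curvefun_poly_pairs[OF h] by (auto simp: real_sections_def)
qed

section \<open>The inflectionary weights\<close>

lemma inflection_weight_at:
  assumes f: "odd (degree f)" "odd (order a f)" and gk: "g \<le> k"
  shows "inflection_weight (div_infinity k f) (series_H k g) (place_at f a)
    = int ((g + 1) choose 2) + int (k - g) * (int (order a f) - 1)"
proof -
  have f0: "f \<noteq> 0" using f(1) by auto
  interpret ramified_place "\<lambda>p. int (order a p)" f using f(2) f0 by (rule ramified_place_at)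
  have "has_value (place_at f a) funX (Some a)"
    using place_at_lies_over(2)[OF f(2) f0] by (simp add: lies_over_def)
  then have D: "div_infinity k f (place_at f a) = 0"
    by (rule div_infinity_at[OF f(1) discrete_valuation_place])
  have "vanishing_orders (div_infinity k f) (series_H k g) (place_at f a)
      = (\<lambda>i. 2 * int i) ` {..<Suc k} \<union> (\<lambda>i. int (order a f) + 2 * int i) ` {..<k - g}"
    unfolding vanishing_orders_series_H orders_at D by (simp add: image_image add.commute)
  from inflection_weight_even_odd[OF this series_rank_series_H] show ?thesis
    using f(2) gk by simp
qed

lemma inflection_weight_infinity:
  assumes f: "odd (degree f)" and gk: "g \<le> k"
  shows "inflection_weight (div_infinity k f) (series_H k g) (place_infinity f)
    = int ((g + 1) choose 2) + int (k - g) * (2 * int g + 1 - int (degree f))"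
proof -
  interpret ramified_place "\<lambda>p. - int (degree p)" f using f by (rule ramified_place_infinity)
  \<comment> \<open>At infinity the orders come out in decreasing order, so both progressions are reversed.\<close>
  have reflect: "(\<lambda>i. c - 2 * int i) ` {..<n} = (\<lambda>i. c - 2 * (int n - 1) + 2 * int i) ` {..<n}" for c n
  proof -
    have "{..<n} = (\<lambda>i. n - Suc i) ` {..<n}"
    proof (intro equalityI subsetI)
      fix i assume "i \<in> {..<n}"
      then have "i = n - Suc (n - Suc i)" "n - Suc i \<in> {..<n}" by auto
      then show "i \<in> (\<lambda>i. n - Suc i) ` {..<n}" by (rule image_eqI)
    qed auto
    then have "(\<lambda>i. c - 2 * int i) ` {..<n} = (\<lambda>i. c - 2 * int (n - Suc i)) ` {..<n}"
      by (metis image_image)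
    also have "\<dots> = (\<lambda>i. c - 2 * (int n - 1) + 2 * int i) ` {..<n}"
      by (intro image_cong) (auto simp: of_nat_diff)
    finally show ?thesis .
  qed
  \<comment> \<open>The least odd order, namely that of \<open>x ^ (k - g - 1) y\<close> if \<open>k > g\<close>.\<close>
  define c where "c = 2 * int g + 2 - int (degree f)"
  have "vanishing_orders (div_infinity k f) (series_H k g) (place_infinity f)
      = (\<lambda>i. 2 * int k - 2 * int i) ` {..<Suc k} \<union>
        (\<lambda>i. 2 * int k - int (degree f) - 2 * int i) ` {..<k - g}"
    unfolding vanishing_orders_series_H orders_infinity div_infinity_infinity[OF f]
    by (simp add: image_image algebra_simps)
  also have "\<dots> = (\<lambda>i. 2 * int i) ` {..<Suc k} \<union> (\<lambda>i. c + 2 * int i) ` {..<k - g}"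
    unfolding reflect using gk by (simp add: c_def of_nat_diff algebra_simps)
  finally have orders: "vanishing_orders (div_infinity k f) (series_H k g) (place_infinity f) = \<dots>" .
  have "odd c" using f by (simp add: c_def)
  from inflection_weight_even_odd[OF orders series_rank_series_H this] show ?thesis
    using gk by (simp add: c_def)
qed

lemma curve_poly_invariants:
  assumes "1 \<le> j" "\<beta> \<noteq> 0" "\<alpha>1 \<noteq> 0" "\<alpha>2 \<noteq> 0" "\<alpha>1 \<noteq> \<alpha>2"
  shows "degree (curve_poly j \<beta> \<alpha>1 \<alpha>2) = 2 * j + 1"
    and "order 0 (curve_poly j \<beta> \<alpha>1 \<alpha>2) = 2 * j - 1"
    and "order \<alpha>1 (curve_poly j \<beta> \<alpha>1 \<alpha>2) = 1"
    and "order \<alpha>2 (curve_poly j \<beta> \<alpha>1 \<alpha>2) = 1"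
proof -
  have nz: "[:0, 1:] ^ (2 * j - 1) \<noteq> (0 :: complex poly)" "[:-\<alpha>1, 1:] \<noteq> 0" "[:-\<alpha>2, 1:] \<noteq> 0"
    by auto
  show "degree (curve_poly j \<beta> \<alpha>1 \<alpha>2) = 2 * j + 1"
    using assms nz by (simp add: curve_poly_def degree_mult_eq degree_power_eq del: mult_pCons_right)
  have lin: "order a [:-b, 1:] = (if a = b then 1 else 0)" for a b :: complex
    using order_power_n_n[of b 1] by (auto intro: order_0I)
  have "order a ([:0, 1:] ^ n) = (if a = 0 then n else 0)" for a :: complex and n
    using order_power_n_n[of 0 n] by (auto intro: order_0I)
  then have ord: "order a (curve_poly j \<beta> \<alpha>1 \<alpha>2)
      = (if a = 0 then 2 * j - 1 else 0) + (if a = \<alpha>1 then 1 else 0) + (if a = \<alpha>2 then 1 else 0)" for a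
    unfolding curve_poly_def using assms(2) nz
    by (simp add: order_smult order_mult lin del: mult_pCons_right mult_pCons_left)
  show "order 0 (curve_poly j \<beta> \<alpha>1 \<alpha>2) = 2 * j - 1" "order \<alpha>1 (curve_poly j \<beta> \<alpha>1 \<alpha>2) = 1"
    "order \<alpha>2 (curve_poly j \<beta> \<alpha>1 \<alpha>2) = 1" using assms unfolding ord by auto
qed

theorem theorem5p3:
  fixes k g j :: nat and \<beta> \<alpha>1 \<alpha>2 :: complex and f :: "complex poly"
  assumes "2 \<le> g" and "g \<le> k"
    and "1 \<le> j" and "j \<le> g"
    and "\<beta> \<noteq> 0" and "\<alpha>1 \<noteq> 0" and "\<alpha>2 \<noteq> 0" and "\<alpha>1 \<noteq> \<alpha>2"
    and f: "f = curve_poly j \<beta> \<alpha>1 \<alpha>2"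
    and real: "\<forall>n. coeff f n \<in> \<real>"
  shows "(\<exists>!P. P \<in> normalization f \<and> has_value P funX (Some 0))
    \<and> (\<exists>!P. P \<in> normalization f \<and> has_value P funX None)
    \<and> (\<exists>!P. P \<in> normalization f \<and> lies_over P (Some \<alpha>1, Some 0))
    \<and> (\<exists>!P. P \<in> normalization f \<and> lies_over P (Some \<alpha>2, Some 0))
    \<and> series_H k g \<subseteq> real_sections f (div_infinity k f)
    \<and> inflection_weight (div_infinity k f) (series_H k g) (point_over_x f (Some 0))
        = int ((g + 1) choose 2) + 2 * (int k - int g) * (int j - 1)
    \<and> inflection_weight (div_infinity k f) (series_H k g) (point_over_x f None)
        = int ((g + 1) choose 2) + 2 * (int k - int g) * (int g - int j)
    \<and> inflection_weight (div_infinity k f) (series_H k g) (point_over f (Some \<alpha>1, Some 0))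
        = int ((g + 1) choose 2)
    \<and> inflection_weight (div_infinity k f) (series_H k g) (point_over f (Some \<alpha>2, Some 0))
        = int ((g + 1) choose 2)
    \<and> inflection_weight (div_infinity k f) (series_H k g) (point_over_x f (Some 0))
        + inflection_weight (div_infinity k f) (series_H k g) (point_over_x f None)
        = 2 * int ((g + 1) choose 2) + 2 * (int k - int g) * (int g - 1)"
proof -
  note inv = curve_poly_invariants[OF assms(3,5-8), folded f]
  have deg: "odd (degree f)" using inv(1) by simp
  have f0: "f \<noteq> 0" using deg by auto
  have odds: "odd (order 0 f)" "odd (order \<alpha>1 f)" "odd (order \<alpha>2 f)"
    using inv(2-4) assms(3) by simp_all
  note at = unique_point_at[OF odds(1) f0] unique_point_at[OF odds(2) f0] unique_point_at[OF odds(3) f0]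
  have pts: "point_over_x f (Some 0) = place_at f 0"
    "point_over f (Some \<alpha>1, Some 0) = place_at f \<alpha>1" "point_over f (Some \<alpha>2, Some 0) = place_at f \<alpha>2"
    unfolding point_over_x_def point_over_def at by simp_all
  have km: "int (k - g) = int k - int g" using assms(2) by simp
  have w0: "inflection_weight (div_infinity k f) (series_H k g) (point_over_x f (Some 0))
      = int ((g + 1) choose 2) + 2 * (int k - int g) * (int j - 1)"
    unfolding pts inflection_weight_at[OF deg odds(1) assms(2)] inv(2) km
    using assms(3) by (simp add: of_nat_diff algebra_simps)
  have winf: "inflection_weight (div_infinity k f) (series_H k g) (point_over_x f None)
      = int ((g + 1) choose 2) + 2 * (int k - int g) * (int g - int j)"
    unfolding point_over_x_infinity[OF deg] inflection_weight_infinity[OF deg assms(2)] inv(1) km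
    by (simp add: algebra_simps)
  have w1: "inflection_weight (div_infinity k f) (series_H k g) (point_over f (Some \<alpha>1, Some 0))
      = int ((g + 1) choose 2)"
    unfolding pts inflection_weight_at[OF deg odds(2) assms(2)] inv(3) by simp
  have w2: "inflection_weight (div_infinity k f) (series_H k g) (point_over f (Some \<alpha>2, Some 0))
      = int ((g + 1) choose 2)"
    unfolding pts inflection_weight_at[OF deg odds(3) assms(2)] inv(4) by simp
  have sec: "series_H k g \<subseteq> real_sections f (div_infinity k f)"
    using deg inv(1) assms(2,4) by (intro series_H_sections) simp_all
  show ?thesis
    unfolding w0 winf w1 w2 at unique_point_infinity[OF deg]
    using sec by (simp add: algebra_simps)
qed

end
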